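(* Let $(n_j,d_j)_{j\ge1}$ be a sequence of pairs of positive integers with $n_j\ge d_j$, such that $d_j\to\infty$ and $n_j-d_j\to\infty$ as $j\to\infty$. Then \[\lim_{j\to\infty}\frac{f(n_j,2^{d_j},d_j)}{\binom{n_j}{d_j}}=c,\qquad\text{where } c=\prod_{i=1}^\infty(1-2^{-i})\approx 0.289.\]
   Context: A family $\mathcal{F}$ of subsets of $[n]=\{1,\dots,n\}$ shatters a set $A\subseteq[n]$ if for every $A'\subseteq A$ there is $F\in\mathcal{F}$ with $F\cap A=A'$. For positive integers $n,k,d$, $f(n,k,d)$ denotes the maximum number of $d$-element subsets of $[n]$ that can be shattered by a family $\mathcal{F}\subseteq 2^{[n]}$ with $|\mathcal{F}|\le k$. *)

theory Defs
  imports "HOL-Analysis.Analysis"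
begin

definition shatters :: "'a set set \<Rightarrow> 'a set \<Rightarrow> bool" where
  "shatters F A \<longleftrightarrow> (\<forall>A'\<subseteq>A. \<exists>S\<in>F. S \<inter> A = A')"

definition shattered_subsets :: "nat \<Rightarrow> nat \<Rightarrow> nat set set \<Rightarrow> nat set set" where
  "shattered_subsets n d F = {A. A \<subseteq> {1..n} \<and> card A = d \<and> shatters F A}"

definition max_shattered :: "nat \<Rightarrow> nat \<Rightarrow> nat \<Rightarrow> nat" where
  "max_shattered n k d =
     Max ((\<lambda>F. card (shattered_subsets n d F)) ` {F. F \<subseteq> Pow {1..n} \<and> card F \<le> k})"

lemma finite_families: "finite {F. F \<subseteq> Pow {1..n::nat} \<and> card F \<le> k}"
  by (rule finite_subset[of _ "Pow (Pow {1..n})"]) auto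

lemma families_nonempty: "{F. F \<subseteq> Pow {1..n::nat} \<and> card F \<le> k} \<noteq> {}"
  by (auto intro: exI[of _ "{}"])

end

theory Submission
  imports Defs
begin

text \<open>Lower bound: for a family that is a random \<open>d\<close>-dimensional linear code over \<open>GF(2)\<close>, a given
  \<open>d\<close>-set is shattered iff a random \<open>d * d\<close> matrix is invertible, which has probability
  \<open>(\<Prod>i=1..d. 1 - 2 ^ -i) \<ge> c\<close>.

  Upper bound: averaging over windows of size \<open>d + m\<close> with \<open>m\<close> fixed reduces to \<open>n = d + m\<close>. There
  a \<open>d\<close>-set is shattered by a family of size \<open>2 ^ d\<close> iff deleting the complementary \<open>m\<close>-set \<open>S\<close> is
  injective on the family; call such an \<open>S\<close> good. If all pairs in \<open>T\<close> are good, then the unit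
  balls in the directions \<open>T\<close> are disjoint, so \<open>1 + card T \<le> 2 ^ m\<close>. Hence the graph of good pairs
  has no clique of size \<open>2 ^ m\<close>, and the good sets through \<open>v\<close> are good \<open>(m - 1)\<close>-sets within the
  neighbourhood of \<open>v\<close>. Induction on \<open>m\<close> together with a Turan bound for the sum of the
  \<open>(m - 1)\<close>-st powers of the degrees shows that the density of good sets is at most that of the
  bases in \<open>GF(2) ^ m\<close> among \<open>m\<close>-tuples of nonzero vectors, up to a factor tending to 1 as
  \<open>d\<close> tends to infinity. This density tends to \<open>c\<close> as \<open>m\<close> tends to infinity.\<close>

section \<open>The Euler product: partial products and numerical value\<close>

definition euler_partial :: "nat \<Rightarrow> real" where
  "euler_partial k = (\<Prod>i<k. 1 - 1 / 2 ^ (i + 1))"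

lemma euler_factor_pos: "0 < 1 - 1 / (2::real) ^ (i + 1)"
proof -
  have "(1::real) < 2 ^ (i + 1)" by (rule one_less_power) auto
  thus ?thesis by simp
qed

lemma euler_partial_pos: "0 < euler_partial k"
  unfolding euler_partial_def by (intro prod_pos) (use euler_factor_pos in auto)

lemma decseq_euler_partial: "decseq euler_partial"
proof (rule decseq_SucI)
  fix k
  have "euler_partial k * (1 - 1 / 2 ^ (k + 1)) \<le> euler_partial k * 1"
    by (intro mult_left_mono) (use euler_partial_pos[of k] in auto)
  thus "euler_partial (Suc k) \<le> euler_partial k" by (simp add: euler_partial_def)
qed

lemma euler_partial_LIMSEQ: "euler_partial \<longlonglongrightarrow> (\<Prod>i. 1 - 1 / 2 ^ (i + 1))"
proof -
  have "summable (\<lambda>i. (1/2::real) * (1/2) ^ i)"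
    by (intro summable_mult summable_geometric) auto
  hence "summable (\<lambda>i. \<bar>- (1 / (2::real) ^ (i + 1))\<bar>)"
    by (simp add: power_divide)
  hence "convergent_prod (\<lambda>i. 1 + - (1 / (2::real) ^ (i + 1)))"
    by (rule summable_imp_convergent_prod_real) (metis add.inverse_inverse diff_self
        euler_factor_pos less_irrefl)
  hence "convergent_prod (\<lambda>i. 1 - 1 / (2::real) ^ (i + 1))" by simp
  from convergent_prod_LIMSEQ[OF this]
  have "(\<lambda>k. euler_partial (Suc k)) \<longlonglongrightarrow> (\<Prod>i. 1 - 1 / 2 ^ (i + 1))"
    by (simp add: euler_partial_def lessThan_Suc_atMost del: prod.lessThan_Suc)
  thus ?thesis by (rule LIMSEQ_imp_Suc)
qed

text \<open>Weierstrass inequality prod (1 - x_i) >= 1 - sum x_i for the factors after the first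
  \<open>N\<close>, where the sum is 1/2^N - 1/2^(N+k). Keeping the last term lets the induction on
  \<open>k\<close> close.\<close>

lemma euler_partial_tail:
  "euler_partial N * (1 - 1 / 2 ^ N + 1 / 2 ^ (N + k)) \<le> euler_partial (N + k)"
proof (induction k)
  case (Suc k)
  define u where "u = 1 / (2::real) ^ (N + k)"
  define v where "v = 1 / (2::real) ^ N"
  have uv: "0 < u" "u \<le> v" unfolding u_def v_def by (auto simp: field_simps power_add)
  have "euler_partial N * (1 - v + u / 2) \<le> euler_partial N * ((1 - v + u) * (1 - u / 2))"
  proof (rule mult_left_mono)
    have "0 \<le> u / 2 * (v - u)" using uv by simp
    thus "1 - v + u / 2 \<le> (1 - v + u) * (1 - u / 2)" by (simp add: field_simps)
  qed (use euler_partial_pos[of N] in simp)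
  also have "\<dots> \<le> euler_partial (N + k) * (1 - u / 2)"
    unfolding mult.assoc[symmetric]
  proof (rule mult_right_mono)
    show "euler_partial N * (1 - v + u) \<le> euler_partial (N + k)"
      using Suc.IH by (simp add: u_def v_def)
    show "0 \<le> 1 - u / 2" using euler_factor_pos[of "N + k"] by (simp add: u_def)
  qed
  finally show ?case by (simp add: u_def v_def euler_partial_def mult.commute)
qed simp

lemma euler_product_bounds:
  defines "c \<equiv> (\<Prod>i. 1 - 1 / 2 ^ (i + 1) :: real)"
  shows "c \<le> euler_partial N" "euler_partial N * (1 - 1 / 2 ^ N) \<le> c"
proof -
  note lim = euler_partial_LIMSEQ[folded c_def]
  show "c \<le> euler_partial N" by (rule decseq_ge[OF decseq_euler_partial lim])
  show "euler_partial N * (1 - 1 / 2 ^ N) \<le> c"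
  proof (rule LIMSEQ_le_const[OF lim], intro exI[of _ N] allI impI)
    fix m assume "N \<le> m"
    then obtain k where m: "m = N + k" using le_Suc_ex by blast
    have "euler_partial N * (1 - 1 / 2 ^ N)
        \<le> euler_partial N * (1 - 1 / 2 ^ N + 1 / 2 ^ (N + k))"
      by (intro mult_left_mono) (use euler_partial_pos[of N] in auto)
    also have "\<dots> \<le> euler_partial m" unfolding m by (rule euler_partial_tail)
    finally show "euler_partial N * (1 - 1 / 2 ^ N) \<le> euler_partial m" .
  qed
qed

lemma euler_product_approx: "\<bar>(\<Prod>i. 1 - 1 / 2 ^ (i + 1)) - (0.289::real)\<bar> < 0.0005"
proof -
  \<comment> \<open>Ten factors suffice: the bounds then differ by about 0.0003, and both lie within
    0.0005 of 0.289.\<close>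
  have "euler_partial 10 < 2895 / 10000" "2885 / 10000 < euler_partial 10 * (1 - 1 / 2 ^ 10)"
    by (simp_all add: euler_partial_def lessThan_nat_numeral)
  with euler_product_bounds[of 10] show ?thesis unfolding abs_less_iff by simp
qed

section \<open>The density of bases over GF(2) and its limit\<close>

text \<open>The probability that \<open>m\<close> independent uniform nonzero vectors of GF(2)^m
  form a basis. The factor for \<open>j\<close> is the Turan factor of the induction step from
  \<open>j\<close> to \<open>j + 1\<close>, with clique bound \<open>2 ^ (j + 1) - 1\<close>; at
  \<open>j = 0\<close> it is \<open>0 ^ 0 = 1\<close>.\<close>

definition good_density :: "nat \<Rightarrow> real" where
  "good_density m = (\<Prod>j<m. (1 - 1 / (2 ^ (j + 1) - 1)) ^ j)"

lemma good_density_Suc: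
  "good_density (Suc p) = good_density p * (1 - 1 / (2 ^ (p + 1) - 1)) ^ p"
  by (simp add: good_density_def)

text \<open>\<open>euler_partial m\<close> is the probability that a uniform \<open>m\<close> by
  \<open>m\<close> matrix over GF(2) is invertible; the power on the left is the probability that no
  row vanishes.\<close>

lemma good_density_eq: "good_density m * (1 - 1 / 2 ^ m) ^ m = euler_partial m"
proof (induction m)
  case (Suc p)
  define q :: real where "q = 2 ^ p"
  have q: "q \<ge> 1" by (simp add: q_def)
  \<comment> \<open>With \<open>q = 2 ^ p\<close>, the factor \<open>2 * q - 1\<close> cancels and
    leaves \<open>(q - 1) / q\<close>.\<close>
  have "(1 - 1 / (2 ^ (p + 1) - 1)) * (1 - 1 / 2 ^ Suc p) = 1 - 1 / (2::real) ^ p"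
    using q by (simp add: q_def[symmetric] field_simps)
  hence "(1 - 1 / (2 ^ (p + 1) - 1)) ^ p * (1 - 1 / 2 ^ Suc p) ^ p = (1 - 1 / (2::real) ^ p) ^ p"
    by (metis power_mult_distrib)
  hence "good_density (Suc p) * (1 - 1 / 2 ^ Suc p) ^ Suc p
      = (good_density p * (1 - 1 / 2 ^ p) ^ p) * (1 - 1 / 2 ^ Suc p)"
    by (simp add: good_density_Suc mult_ac)
  also have "\<dots> = euler_partial (Suc p)" unfolding Suc.IH by (simp add: euler_partial_def)
  finally show ?case .
qed (simp add: good_density_def euler_partial_def)

lemma good_density_LIMSEQ: "good_density \<longlonglongrightarrow> (\<Prod>i. 1 - 1 / 2 ^ (i + 1))"
proof -
  have "(\<lambda>m. (1 - 1 / (2::real) ^ m) ^ m) \<longlonglongrightarrow> 1" by real_asymp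
  hence "(\<lambda>m. euler_partial m / (1 - 1 / 2 ^ m) ^ m) \<longlonglongrightarrow> (\<Prod>i. 1 - 1 / 2 ^ (i + 1)) / 1"
    by (intro tendsto_divide euler_partial_LIMSEQ) auto
  moreover have "eventually (\<lambda>m. euler_partial m / (1 - 1 / 2 ^ m) ^ m = good_density m) sequentially"
    using eventually_gt_at_top[of 0]
  proof eventually_elim
    case (elim m)
    hence "(1::real) < 2 ^ m" by (intro one_less_power) auto
    hence "(1 - 1 / (2::real) ^ m) ^ m \<noteq> 0" by auto
    thus ?case by (simp add: field_simps flip: good_density_eq)
  qed
  ultimately show ?thesis by (simp add: tendsto_cong)
qed

lemma good_density_nonneg: "0 \<le> good_density m"
  unfolding good_density_def
proof (intro prod_nonneg ballI zero_le_power)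
  fix j :: nat
  have "(1::real) \<le> 2 ^ (j + 1) - 1" by simp
  hence "1 / ((2::real) ^ (j + 1) - 1) \<le> 1" by (subst divide_le_eq_1) linarith
  thus "0 \<le> 1 - 1 / ((2::real) ^ (j + 1) - 1)" by simp
qed

section \<open>Tangent-line bound for x (1 - x)^p\<close>

text \<open>The polynomial has a double zero at \<open>t = 1\<close>. Passing from \<open>p\<close>
  to \<open>p + 1\<close> multiplies it by \<open>t\<close> and adds
  \<open>(1 - t) * (1 - t ^ (p + 1))\<close>, whose two factors never have opposite signs.\<close>

lemma power_tangent_nonneg:
  fixes t :: real
  assumes "0 \<le> t"
  shows "0 \<le> real p * t ^ (p + 1) - real (p + 1) * t ^ p + 1"
proof (induction p)
  case (Suc p)
  have "0 \<le> (1 - t) * (1 - t ^ (p + 1))"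
  proof (cases "t \<le> 1")
    case True
    thus ?thesis using assms by (intro mult_nonneg_nonneg) (auto simp: power_le_one mult_le_one)
  next
    case False
    thus ?thesis using one_le_power[of t "p + 1"] by (intro mult_nonpos_nonpos) auto
  qed
  moreover have "0 \<le> t * (real p * t ^ (p + 1) - real (p + 1) * t ^ p + 1)"
    using Suc assms by simp
  ultimately have "0 \<le> t * (real p * t ^ (p + 1) - real (p + 1) * t ^ p + 1)
      + (1 - t) * (1 - t ^ (p + 1))" by simp
  also have "\<dots> = real (Suc p) * t ^ (Suc p + 1) - real (Suc p + 1) * t ^ Suc p + 1"
    by (simp add: algebra_simps)
  finally show ?case .
qed simp

text \<open>The line is the tangent at \<open>a\<close>. After substituting \<open>1 - a = b\<close> and \<open>1 - x = b * t\<close> the claim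
  reads \<open>A p \<le> b * A (p + 1)\<close> with \<open>A q = t ^ q - q * t + q - 1\<close>, where \<open>p / (p + 1) \<le> b\<close>.\<close>

lemma mult_power_tangent_line:
  fixes a :: real
  assumes a: "0 < a" "real (p + 1) * a \<le> 1"
  obtains s where "\<And>x. 0 \<le> x \<Longrightarrow> x \<le> 1 \<Longrightarrow> x * (1 - x) ^ p \<le> a * (1 - a) ^ p + s * (x - a)"
proof (cases "p = 0")
  case True
  thus ?thesis using that[of 1] by simp
next
  case False
  define b where "b = 1 - a"
  have "a < real (p + 1) * a" using False a by simp
  hence b: "0 < b" "real p \<le> real (p + 1) * b" using a by (auto simp: b_def algebra_simps)
  define s where "s = b ^ p * (real (p + 1) * b - real p) / b"
  show ?thesis
  proof (rule that[of s])
    fix x :: real assume x: "0 \<le> x" "x \<le> 1"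
    define t where "t = (1 - x) / b"
    have t: "0 \<le> t" "1 - x = b * t" using b x by (auto simp: t_def)
    define B where "B = t ^ (p + 1) - real (p + 1) * t + real p"
    define A where "A = t ^ p - real p * t + (real p - 1)"
    have B: "0 \<le> B"
      using Bernoulli_inequality[of "t - 1" "p + 1"] t(1) by (simp add: B_def algebra_simps)
    have "0 \<le> (real (p + 1) * b - real p) * B" using B b by simp
    \<comment> \<open>The added polynomial is \<open>p * B - (p + 1) * A\<close>, in which the
      linear terms cancel.\<close>
    hence "0 \<le> (real (p + 1) * b - real p) * B
        + (real p * t ^ (p + 1) - real (p + 1) * t ^ p + 1)"
      using power_tangent_nonneg[OF t(1), of p] by linarith
    also have "\<dots> = real (p + 1) * (b * B - A)"
      unfolding A_def B_def by (simp add: algebra_simps)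
    finally have "0 \<le> b * B - A" by (simp add: zero_le_mult_iff)
    hence "0 \<le> b ^ p * (b * B - A)" using b by simp
    also have "\<dots> = (1 - b) * b ^ p + b ^ p * (real (p + 1) * b - real p) * (1 - t)
        - (1 - b * t) * (b ^ p * t ^ p)"
      unfolding A_def B_def by (simp add: algebra_simps)
    also have "b ^ p * (real (p + 1) * b - real p) * (1 - t) = s * (b - b * t)"
      using b by (simp add: s_def field_simps)
    also have "b - b * t = x - a" using t by (simp add: b_def)
    also have "1 - b * t = x" using t by simp
    also have "b ^ p * t ^ p = (1 - x) ^ p" using t by (simp add: power_mult_distrib)
    finally show "x * (1 - x) ^ p \<le> a * (1 - a) ^ p + s * (x - a)" by (simp add: b_def)
  qed
qed

section \<open>Turan bound for sums of degree powers\<close>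

text \<open>Erdos' degree majorisation: split off the complement of the neighbourhood of a vertex of
  maximal degree as one colour class.\<close>

lemma degree_majorisation:
  assumes "finite V" and sym: "\<And>u v. E u v \<Longrightarrow> E v u" and irr: "\<And>u. \<not> E u u"
    and "\<And>T. T \<subseteq> V \<Longrightarrow> (\<forall>u\<in>T. \<forall>v\<in>T. u \<noteq> v \<longrightarrow> E u v) \<Longrightarrow> card T \<le> r"
  shows "\<exists>f. f ` V \<subseteq> {..<r} \<and> (\<forall>v\<in>V. card {u\<in>V. E v u} \<le> card {u\<in>V. f u \<noteq> f v})"
  using assms(1,4)
proof (induction r arbitrary: V)
  case 0
  have "v \<notin> V" for v using "0.prems"(2)[of "{v}"] by auto
  thus ?case by auto
next
  case (Suc r)
  show ?case
  proof (cases "V = {}")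
    case False
    define deg where "deg v = card {u\<in>V. E v u}" for v
    have "Max (deg ` V) \<in> deg ` V" using Suc.prems(1) False by (intro Max_in) auto
    then obtain w where "w \<in> V" "deg w = Max (deg ` V)" by auto
    with Suc.prems(1) have w: "w \<in> V" "\<And>v. v \<in> V \<Longrightarrow> deg v \<le> deg w" by auto
    define M where "M = {u\<in>V. E w u}"
    have fin: "finite M" using Suc.prems(1) by (simp add: M_def)
    \<comment> \<open>Adding \<open>w\<close> to a clique of neighbours of \<open>w\<close> gives a
      larger clique.\<close>
    have "card T \<le> r" if T: "T \<subseteq> M" "\<forall>u\<in>T. \<forall>v\<in>T. u \<noteq> v \<longrightarrow> E u v" for T
    proof -
      have "w \<notin> T" "finite T" using T(1) irr fin by (auto simp: M_def intro: finite_subset)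
      moreover have "card (insert w T) \<le> Suc r"
        using T w(1) sym by (intro Suc.prems(2)) (auto simp: M_def)
      ultimately show ?thesis by simp
    qed
    from Suc.IH[OF fin this] obtain g where g: "g ` M \<subseteq> {..<r}"
      "\<And>v. v \<in> M \<Longrightarrow> card {u\<in>M. E v u} \<le> card {u\<in>M. g u \<noteq> g v}" by auto
    define f where "f u = (if u \<in> M then g u else r)" for u
    have gr: "g u < r" if "u \<in> M" for u using g(1) that by auto
    have "deg v \<le> card {u\<in>V. f u \<noteq> f v}" if v: "v \<in> V" for v
    proof (cases "v \<in> M")
      case True
      have "deg v \<le> card ({u\<in>M. E v u} \<union> (V - M))"
        unfolding deg_def using Suc.prems(1) fin by (intro card_mono) auto
      also have "\<dots> \<le> card {u\<in>M. E v u} + card (V - M)" by (rule card_Un_le)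
      also have "\<dots> \<le> card {u\<in>M. g u \<noteq> g v} + card (V - M)" using g(2)[OF True] by simp
      also have "\<dots> = card ({u\<in>M. g u \<noteq> g v} \<union> (V - M))"
        using Suc.prems(1) fin by (subst card_Un_disjoint) auto
      also have "{u\<in>M. g u \<noteq> g v} \<union> (V - M) = {u\<in>V. f u \<noteq> f v}"
        using gr True by (auto simp: f_def M_def)
      finally show ?thesis .
    next
      case False
      \<comment> \<open>Here \<open>v\<close> has the new colour \<open>r\<close>, so the vertices
        of other colours are exactly those of \<open>M\<close>, and \<open>card M\<close> is the
        maximal degree.\<close>
      have "deg v \<le> card M" using w(2)[OF v] by (simp add: deg_def M_def)
      also have "M = {u\<in>V. f u \<noteq> f v}" using gr False by (force simp: f_def M_def)
      finally show ?thesis .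
    qed
    moreover have "f ` V \<subseteq> {..<Suc r}" using gr by (auto simp: f_def intro: less_SucI)
    ultimately show ?thesis unfolding deg_def by blast
  qed auto
qed

lemma card_filter_add_card_filter_not:
  assumes "finite V"
  shows "card {x\<in>V. P x} + card {x\<in>V. \<not> P x} = card V"
proof -
  have "{x\<in>V. P x} \<union> {x\<in>V. \<not> P x} = V" by blast
  moreover have "card ({x\<in>V. P x} \<union> {x\<in>V. \<not> P x}) = card {x\<in>V. P x} + card {x\<in>V. \<not> P x}"
    using assms by (intro card_Un_disjoint) auto
  ultimately show ?thesis by simp
qed

text \<open>Majorisation by a complete \<open>r\<close>-partite graph with class proportions
  \<open>x i\<close> bounds the sum by \<open>N ^ (p + 1)\<close> times the sum of
  \<open>x i * (1 - x i) ^ p\<close>. The tangent at \<open>1 / r\<close> applies because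
  \<open>p < r\<close>, and its linear terms cancel since the \<open>x i\<close> add up to
  1.\<close>

lemma sum_degree_power_le:
  assumes "finite V" and sym: "\<And>u v. E u v \<Longrightarrow> E v u" and irr: "\<And>u. \<not> E u u"
    and clique: "\<And>T. T \<subseteq> V \<Longrightarrow> (\<forall>u\<in>T. \<forall>v\<in>T. u \<noteq> v \<longrightarrow> E u v) \<Longrightarrow> card T \<le> r"
    and r: "p < r"
  shows "(\<Sum>v\<in>V. real (card {u\<in>V. E v u}) ^ p) \<le> (1 - 1 / real r) ^ p * real (card V) ^ (p + 1)"
proof (cases "V = {}")
  case False
  obtain f where f: "f ` V \<subseteq> {..<r}"
    "\<And>v. v \<in> V \<Longrightarrow> card {u\<in>V. E v u} \<le> card {u\<in>V. f u \<noteq> f v}"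
    using degree_majorisation[of V E r, OF assms(1) sym irr clique] by blast
  define N where "N = real (card V)"
  define x where "x i = real (card {u\<in>V. f u = i}) / N" for i
  have N: "N > 0" using False assms(1) by (simp add: N_def card_gt_0_iff)
  have x: "0 \<le> x i" "x i \<le> 1" for i
    using N assms(1) by (auto simp: x_def N_def intro!: card_mono)
  have cx: "real (card {u\<in>V. f u = i}) = N * x i" for i using N by (simp add: x_def)
  have co: "real (card {u\<in>V. f u \<noteq> i}) = N * (1 - x i)" for i
  proof -
    have "card {u\<in>V. f u = i} + card {u\<in>V. f u \<noteq> i} = card V"
      using assms(1) by (rule card_filter_add_card_filter_not)
    thus ?thesis using cx[of i] by (simp add: N_def algebra_simps flip: of_nat_add)
  qed
  have sumx: "(\<Sum>i<r. x i) = 1"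
  proof -
    have "(\<Sum>i<r. \<Sum>u\<in>{u\<in>V. f u = i}. 1) = (\<Sum>u\<in>V. (1::real))"
      using f(1) assms(1) by (intro sum.group) auto
    hence "(\<Sum>i<r. N * x i) = N" by (simp add: cx N_def)
    hence "N * (\<Sum>i<r. x i) = N" by (simp add: sum_distrib_left)
    thus ?thesis using N by simp
  qed
  obtain s where s: "\<And>x. 0 \<le> x \<Longrightarrow> x \<le> 1 \<Longrightarrow>
      x * (1 - x) ^ p \<le> 1 / real r * (1 - 1 / real r) ^ p + s * (x - 1 / real r)"
    by (rule mult_power_tangent_line[of "1 / real r" p]) (use r in auto)
  have "(\<Sum>v\<in>V. real (card {u\<in>V. E v u}) ^ p) \<le> (\<Sum>v\<in>V. (N * (1 - x (f v))) ^ p)"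
    unfolding co[symmetric] using f(2) by (intro sum_mono power_mono) auto
  also have "\<dots> = (\<Sum>i<r. \<Sum>v\<in>{v\<in>V. f v = i}. (N * (1 - x (f v))) ^ p)"
    using f(1) assms(1) by (intro sum.group[symmetric]) auto
  also have "\<dots> = (\<Sum>i<r. N * x i * (N * (1 - x i)) ^ p)"
    by (intro sum.cong refl) (simp add: cx)
  also have "\<dots> = N ^ (p + 1) * (\<Sum>i<r. x i * (1 - x i) ^ p)"
    by (simp add: sum_distrib_left power_mult_distrib mult_ac)
  also have "(\<Sum>i<r. x i * (1 - x i) ^ p)
      \<le> (\<Sum>i<r. 1 / real r * (1 - 1 / real r) ^ p + s * (x i - 1 / real r))"
    using x by (intro sum_mono s)
  also have "\<dots> = (1 - 1 / real r) ^ p"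
    using r by (simp add: sum.distrib sum_subtractf sumx flip: sum_distrib_left)
  finally show ?thesis using N by (simp add: N_def mult.commute)
qed auto

section \<open>Counting good sets\<close>

text \<open>The words of \<open>F\<close> together with their single-coordinate changes in \<open>T\<close> are distinct.\<close>

lemma card_packing_le:
  fixes W :: "'a set"
  assumes "finite W" "F \<subseteq> Pow W" "T \<subseteq> W"
    and inj: "\<And>u v. u \<in> T \<Longrightarrow> v \<in> T \<Longrightarrow> inj_on (\<lambda>x. x - {u, v}) F"
  shows "card F * (1 + card T) \<le> 2 ^ card W"
proof (cases "T = {}")
  case True
  thus ?thesis using card_mono[of "Pow W" F] assms by (simp add: card_Pow)
next
  case False
  then obtain t0 where t0: "t0 \<in> T" by blast
  define \<phi> :: "'a set \<times> 'a option \<Rightarrow> 'a set" where "\<phi> = (\<lambda>(x, a). case a of None \<Rightarrow> x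
      | Some t \<Rightarrow> if t \<in> x then x - {t} else insert t x)"
  have fin: "finite T" using assms finite_subset by blast
  have "inj_on \<phi> (F \<times> insert None (Some ` T))"
  proof (rule inj_onI, clarify)
    fix x a y b
    assume x: "x \<in> F" and y: "y \<in> F" and a: "a \<in> insert None (Some ` T)"
      and b: "b \<in> insert None (Some ` T)" and eq: "\<phi> (x, a) = \<phi> (y, b)"
    \<comment> \<open>\<open>None\<close> flips nothing, so \<open>t0\<close> is an arbitrary
      default. Deleting \<open>{u, v}\<close> erases both flips, and the hypothesis covers
      \<open>u = v\<close> too.\<close>
    define u where "u = (case a of None \<Rightarrow> t0 | Some t \<Rightarrow> t)"
    define v where "v = (case b of None \<Rightarrow> t0 | Some t \<Rightarrow> t)"
    have uv: "u \<in> T" "v \<in> T" using a b t0 by (auto simp: u_def v_def)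
    have "x - {u, v} = \<phi> (x, a) - {u, v}" by (auto simp: \<phi>_def u_def split: option.splits)
    moreover have "y - {u, v} = \<phi> (y, b) - {u, v}" by (auto simp: \<phi>_def v_def split: option.splits)
    ultimately have "x = y" using inj[OF uv] x y eq by (auto simp: inj_on_def)
    moreover from this have "a = b" using eq
      by (auto simp: \<phi>_def split: option.splits if_splits)
    ultimately show "x = y \<and> a = b" by simp
  qed
  moreover have "\<phi> ` (F \<times> insert None (Some ` T)) \<subseteq> Pow W"
    using assms(2,3) by (fastforce simp: \<phi>_def split: if_splits)
  ultimately have "card (F \<times> insert None (Some ` T)) \<le> card (Pow W)"
    using assms(1) by (intro card_inj_on_le[of \<phi>]) auto
  moreover have "card (insert None (Some ` T)) = 1 + card T"
    using fin by (subst card_insert_disjoint) (auto simp: card_image)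
  ultimately show ?thesis unfolding card_cartesian_product card_Pow[OF assms(1)] by metis
qed

text \<open>The set \<open>V\<close> of candidate elements is kept apart from the ground set of
  \<open>F\<close>: the induction shrinks \<open>V\<close> to a neighbourhood, while
  \<open>F\<close> loses a single coordinate.\<close>

definition good_sets :: "'a set set \<Rightarrow> 'a set \<Rightarrow> nat \<Rightarrow> 'a set set" where
  "good_sets F V m = {S. S \<subseteq> V \<and> card S = m \<and> inj_on (\<lambda>x. x - S) F}"

lemma inj_on_diff_mono:
  assumes "inj_on (\<lambda>x. x - S) F" "T \<subseteq> S"
  shows "inj_on (\<lambda>x. x - T) F"
proof (rule inj_onI)
  fix x y assume xy: "x \<in> F" "y \<in> F" "x - T = y - T"
  hence "x - S = y - S" using assms(2) by blast
  thus "x = y" using xy assms(1) by (auto dest: inj_onD)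
qed

text \<open>Deleting \<open>v\<close> turns the good sets through \<open>v\<close> into good sets of a family of the same kind,
  supported on the \<open>u\<close> for which \<open>{u, v}\<close> is good. By the packing bound this pair graph has no
  clique of size \<open>2 ^ m\<close>.\<close>

lemma card_good_sets_le:
  assumes "finite W" "F \<subseteq> Pow W" "card F * 2 ^ m = 2 ^ card W" "V \<subseteq> W"
  shows "fact m * real (card (good_sets F V m)) \<le> good_density m * real (card V) ^ m"
  using assms
proof (induction m arbitrary: W F V)
  case 0
  have "finite V" using "0.prems"(1,4) finite_subset by blast
  hence "S = {}" if "S \<in> good_sets F V 0" for S
    using that finite_subset[of S V] by (auto simp: good_sets_def)
  hence "good_sets F V 0 \<subseteq> {{}}" by blast
  from card_mono[OF _ this] have "card (good_sets F V 0) \<le> 1" by simp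
  thus ?case by (simp add: good_density_def)
next
  case (Suc p)
  note fW = Suc.prems(1) and FW = Suc.prems(2) and cF = Suc.prems(3) and VW = Suc.prems(4)
  have fV: "finite V" using VW fW finite_subset by blast
  have fG: "finite (good_sets F V (Suc p))"
    by (rule finite_subset[of _ "Pow V"]) (use fV in \<open>auto simp: good_sets_def\<close>)
  define E where "E u v \<longleftrightarrow> u \<noteq> v \<and> inj_on (\<lambda>x. x - {u, v}) F" for u v
  define r :: nat where "r = 2 ^ (p + 1) - 1"
  have r: "p < r" "real r = 2 ^ (p + 1) - 1"
  proof -
    have "p + 1 < 2 ^ (p + 1)" by (rule less_exp)
    thus "p < r" "real r = 2 ^ (p + 1) - 1" by (auto simp: r_def of_nat_diff)
  qed
  have "card T \<le> r" if T: "T \<subseteq> V" "\<forall>u\<in>T. \<forall>v\<in>T. u \<noteq> v \<longrightarrow> E u v" for T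
  \<comment> \<open>\<open>E\<close> is irreflexive, but the packing bound also asks for
    \<open>u = v\<close>. A second element of \<open>T\<close> supplies that case by monotonicity,
    so smaller \<open>T\<close> are treated apart.\<close>
  proof (cases "card T \<le> 1")
    case True
    thus ?thesis using r(1) by simp
  next
    case False
    have "inj_on (\<lambda>x. x - {u, v}) F" if uv: "u \<in> T" "v \<in> T" for u v
    proof (cases "u = v")
      case True
      have "\<exists>w\<in>T. w \<noteq> u"
      proof (rule ccontr)
        assume "\<not> ?thesis"
        hence "T \<subseteq> {u}" by auto
        hence "card T \<le> card {u}" by (intro card_mono) auto
        thus False using False by simp
      qed
      then obtain w where "w \<in> T" "w \<noteq> u" by blast
      hence "inj_on (\<lambda>x. x - {u, w}) F" using T(2) uv by (auto simp: E_def)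
      thus ?thesis using True by (auto intro: inj_on_diff_mono)
    qed (use T(2) uv in \<open>auto simp: E_def\<close>)
    hence "card F * (1 + card T) \<le> card F * 2 ^ Suc p"
      unfolding cF using fW FW T(1) VW by (intro card_packing_le) auto
    moreover have "card F > 0" using cF by (intro Nat.gr0I) auto
    ultimately have "1 + card T \<le> 2 ^ Suc p" using mult_le_cancel1 by blast
    thus ?thesis by (simp add: r_def)
  qed
  hence deg: "(\<Sum>v\<in>V. real (card {u\<in>V. E v u}) ^ p)
      \<le> (1 - 1 / real r) ^ p * real (card V) ^ (p + 1)"
    using fV r(1) by (intro sum_degree_power_le) (auto simp: E_def insert_commute)
  have link: "fact p * real (card {S \<in> good_sets F V (Suc p). v \<in> S})
      \<le> good_density p * real (card {u\<in>V. E v u}) ^ p" if v: "v \<in> V" for v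
  proof (cases "{S \<in> good_sets F V (Suc p). v \<in> S} = {}")
    case True
    thus ?thesis using good_density_nonneg[of p] by (auto simp del: Collect_empty_eq)
  next
    case False
    then obtain S0 where S0: "S0 \<in> good_sets F V (Suc p)" "v \<in> S0" by blast
    \<comment> \<open>A good set through \<open>v\<close> makes deletion of \<open>v\<close>
      injective. Thus \<open>F'\<close> has the size of \<open>F\<close> on one coordinate fewer,
      which is the size hypothesis for \<open>p\<close>.\<close>
    define F' where "F' = (\<lambda>x. x - {v}) ` F"
    have "inj_on (\<lambda>x. x - {v}) F"
      using S0 by (auto simp: good_sets_def intro: inj_on_diff_mono)
    hence cF': "card F' = card F" by (simp add: F'_def card_image)
    have "card W = Suc (card (W - {v}))" using v VW fW by (metis card.remove subsetD)
    hence "card F' * 2 ^ p = 2 ^ card (W - {v})" using cF by (simp add: cF')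
    hence IH: "fact p * real (card (good_sets F' {u\<in>V. E v u} p))
        \<le> good_density p * real (card {u\<in>V. E v u}) ^ p"
      using fW FW VW by (intro Suc.IH[of "W - {v}"]) (auto simp: F'_def E_def)
    have "card {S \<in> good_sets F V (Suc p). v \<in> S} \<le> card (good_sets F' {u\<in>V. E v u} p)"
    proof (rule card_inj_on_le[of "\<lambda>S. S - {v}"])
      show "inj_on (\<lambda>S. S - {v}) {S \<in> good_sets F V (Suc p). v \<in> S}"
        by (auto simp: inj_on_def)
      show "finite (good_sets F' {u\<in>V. E v u} p)"
        by (rule finite_subset[of _ "Pow V"]) (use fV in \<open>auto simp: good_sets_def\<close>)
      show "(\<lambda>S. S - {v}) ` {S \<in> good_sets F V (Suc p). v \<in> S} \<subseteq> good_sets F' {u\<in>V. E v u} p"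
      proof clarify
        fix S assume S: "S \<in> good_sets F V (Suc p)" and vS: "v \<in> S"
        have inj: "inj_on (\<lambda>x. x - S) F" using S by (simp add: good_sets_def)
        have "inj_on (\<lambda>x. x - (S - {v})) F'" unfolding F'_def
        proof (rule inj_on_imageI)
          have "(\<lambda>x. x - (S - {v})) \<circ> (\<lambda>x. x - {v}) = (\<lambda>x. x - S)" using vS by auto
          thus "inj_on ((\<lambda>x. x - (S - {v})) \<circ> (\<lambda>x. x - {v})) F" using inj by simp
        qed
        moreover have "E v u" if "u \<in> S - {v}" for u
          unfolding E_def using that vS by (auto intro: inj_on_diff_mono[OF inj])
        moreover have "card (S - {v}) = p" using S vS by (simp add: good_sets_def)
        ultimately show "S - {v} \<in> good_sets F' {u\<in>V. E v u} p"
          using S by (auto simp: good_sets_def)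
      qed
    qed
    hence "fact p * real (card {S \<in> good_sets F V (Suc p). v \<in> S})
        \<le> fact p * real (card (good_sets F' {u\<in>V. E v u} p))"
      by (intro mult_left_mono) auto
    with IH show ?thesis by linarith
  qed
  \<comment> \<open>Each good set is counted once for each of its \<open>Suc p\<close> elements;
    this turns \<open>fact p\<close> into \<open>fact (Suc p)\<close>.\<close>
  have "(\<Sum>v\<in>V. card {S \<in> good_sets F V (Suc p). v \<in> S}) = Suc p * card (good_sets F V (Suc p))"
  proof (rule sum_multicount[OF fV fG], clarify)
    fix S assume "S \<in> good_sets F V (Suc p)"
    hence "{v\<in>V. v \<in> S} = S" "card S = Suc p" by (auto simp: good_sets_def)
    thus "card {v\<in>V. v \<in> S} = Suc p" by simp
  qed
  hence count: "real (Suc p) * real (card (good_sets F V (Suc p)))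
      = (\<Sum>v\<in>V. real (card {S \<in> good_sets F V (Suc p). v \<in> S}))"
    by (metis of_nat_mult of_nat_sum)
  have "fact (Suc p) * real (card (good_sets F V (Suc p)))
      = fact p * (real (Suc p) * real (card (good_sets F V (Suc p))))"
    by (simp add: algebra_simps)
  also have "\<dots> = (\<Sum>v\<in>V. fact p * real (card {S \<in> good_sets F V (Suc p). v \<in> S}))"
    unfolding count by (simp add: sum_distrib_left)
  also have "\<dots> \<le> (\<Sum>v\<in>V. good_density p * real (card {u\<in>V. E v u}) ^ p)"
    by (intro sum_mono link)
  also have "\<dots> \<le> good_density p * ((1 - 1 / real r) ^ p * real (card V) ^ (p + 1))"
    unfolding sum_distrib_left[symmetric]
    by (intro mult_left_mono deg good_density_nonneg)
  also have "\<dots> = good_density (Suc p) * real (card V) ^ Suc p"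
    unfolding good_density_Suc r(2) by simp
  finally show ?case .
qed

section \<open>Upper bound by averaging over windows\<close>

lemma shatters_iff_image: "shatters F A \<longleftrightarrow> (\<lambda>x. x \<inter> A) ` F = Pow A"
proof
  assume "shatters F A"
  thus "(\<lambda>x. x \<inter> A) ` F = Pow A" unfolding shatters_def by (auto simp: image_iff)
next
  assume "(\<lambda>x. x \<inter> A) ` F = Pow A"
  thus "shatters F A" unfolding shatters_def by (metis Pow_iff imageE)
qed

text \<open>One shattered \<open>d\<close>-set already forces the trace of \<open>F\<close> on
  \<open>W\<close> to have exactly \<open>2 ^ d\<close> members, and restriction to that set to be
  injective on them. Complements of shattered sets in \<open>W\<close> are therefore good.\<close>

lemma card_shattered_window_le:
  assumes fW: "finite W" "card W = d + m" and F: "finite F" "card F \<le> 2 ^ d"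
  shows "fact m * real (card {A. A \<subseteq> W \<and> card A = d \<and> shatters F A})
    \<le> good_density m * real (d + m) ^ m"
proof (cases "{A. A \<subseteq> W \<and> card A = d \<and> shatters F A} = {}")
  case True
  thus ?thesis using good_density_nonneg[of m] by (simp del: Collect_empty_eq)
next
  case False
  define F' where "F' = (\<lambda>x. x \<inter> W) ` F"
  have fF': "finite F'" "card F' \<le> 2 ^ d"
    using F card_image_le[OF F(1), of "\<lambda>x. x \<inter> W"] by (auto simp: F'_def)
  have *: "card F' = 2 ^ d \<and> inj_on (\<lambda>x. x - (W - A)) F'"
    if A: "A \<subseteq> W" "card A = d" "shatters F A" for A
  proof -
    have fA: "finite A" using A(1) fW(1) finite_subset by blast
    have "(\<lambda>x. x - (W - A)) ` F' = (\<lambda>x. x \<inter> A) ` F"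
      unfolding F'_def image_image using A(1) by (intro image_cong) auto
    also have "\<dots> = Pow A" using A(3) by (simp add: shatters_iff_image)
    finally have "card ((\<lambda>x. x - (W - A)) ` F') = 2 ^ d" using A(2) fA by (simp add: card_Pow)
    moreover from this have "card F' = 2 ^ d"
      using fF' card_image_le[OF fF'(1), of "\<lambda>x. x - (W - A)"] by simp
    ultimately show ?thesis using fF'(1) by (auto intro: eq_card_imp_inj_on)
  qed
  from False obtain A0 where "A0 \<subseteq> W" "card A0 = d" "shatters F A0" by blast
  hence cF': "card F' = 2 ^ d" using * by blast
  have "card {A. A \<subseteq> W \<and> card A = d \<and> shatters F A} \<le> card (good_sets F' W m)"
  proof (rule card_inj_on_le[of "\<lambda>A. W - A"])
    show "inj_on (\<lambda>A. W - A) {A. A \<subseteq> W \<and> card A = d \<and> shatters F A}"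
      by (auto simp: inj_on_def)
    show "finite (good_sets F' W m)"
      by (rule finite_subset[of _ "Pow W"]) (use fW in \<open>auto simp: good_sets_def\<close>)
    show "(\<lambda>A. W - A) ` {A. A \<subseteq> W \<and> card A = d \<and> shatters F A} \<subseteq> good_sets F' W m"
    proof clarify
      fix A assume A: "A \<subseteq> W" "d = card A" "shatters F A"
      have "card (W - A) = m" using A fW finite_subset by (subst card_Diff_subset) auto
      thus "W - A \<in> good_sets F' W m" using * A by (auto simp: good_sets_def)
    qed
  qed
  hence "fact m * real (card {A. A \<subseteq> W \<and> card A = d \<and> shatters F A})
      \<le> fact m * real (card (good_sets F' W m))"
    by (intro mult_left_mono) auto
  also have "\<dots> \<le> good_density m * real (card W) ^ m"
    by (rule card_good_sets_le) (use fW cF' in \<open>auto simp: F'_def power_add\<close>)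
  finally show ?thesis using fW(2) by simp
qed

lemma card_supersets:
  assumes "finite X" "A \<subseteq> X"
  shows "card {W. W \<subseteq> X \<and> card W = card A + m \<and> A \<subseteq> W} = (card X - card A choose m)"
proof -
  have fA: "finite A" using assms finite_subset by blast
  have "bij_betw (\<lambda>B. A \<union> B) {B. B \<subseteq> X - A \<and> card B = m}
      {W. W \<subseteq> X \<and> card W = card A + m \<and> A \<subseteq> W}"
  proof (rule bij_betw_byWitness[of _ "\<lambda>W. W - A"])
    show "(\<lambda>B. A \<union> B) ` {B. B \<subseteq> X - A \<and> card B = m}
        \<subseteq> {W. W \<subseteq> X \<and> card W = card A + m \<and> A \<subseteq> W}"
    proof clarify
      fix B assume B: "B \<subseteq> X - A" "m = card B"
      have "finite B" using B assms finite_subset by blast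
      hence "card (A \<union> B) = card A + card B" using B fA by (intro card_Un_disjoint) auto
      thus "A \<union> B \<subseteq> X \<and> card (A \<union> B) = card A + card B \<and> A \<subseteq> A \<union> B" using B assms by auto
    qed
    show "(\<lambda>W. W - A) ` {W. W \<subseteq> X \<and> card W = card A + m \<and> A \<subseteq> W}
        \<subseteq> {B. B \<subseteq> X - A \<and> card B = m}"
      using fA by (auto simp: card_Diff_subset)
  qed auto
  hence "card {B. B \<subseteq> X - A \<and> card B = m}
      = card {W. W \<subseteq> X \<and> card W = card A + m \<and> A \<subseteq> W}"
    by (rule bij_betw_same_card)
  thus ?thesis using assms fA by (simp add: n_subsets card_Diff_subset)
qed

lemma fact_mult_power_le: "fact d * d ^ m \<le> (fact (d + m) :: nat)"
proof (induction m)
  case (Suc m)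
  have "fact d * d ^ Suc m = d * (fact d * d ^ m)" by simp
  also have "\<dots> \<le> (d + m + 1) * fact (d + m)" by (intro mult_mono Suc.IH) auto
  finally show ?case by simp
qed simp

text \<open>Double counting of pairs of a shattered set and a window of size \<open>d + m\<close>
  containing it. Trinomial revision \<open>N * K = a * b\<close> turns the count into a density, and
  \<open>real d ^ m \<le> fact m * K\<close> leaves the error factor.\<close>

lemma card_shattered_subsets_le:
  assumes d: "0 < d" "d + m \<le> n" and F: "F \<subseteq> Pow {1..n}" "card F \<le> 2 ^ d"
  shows "real (card (shattered_subsets n d F)) / real (n choose d)
    \<le> good_density m * (real (d + m) / real d) ^ m"
proof -
  define Ws where "Ws = {W. W \<subseteq> {1..n} \<and> card W = d + m}"
  define As where "As = shattered_subsets n d F"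
  have fin: "finite Ws" "finite As" "finite F"
    by (rule finite_subset[of _ "Pow {1..n}"]; use F in \<open>auto simp: Ws_def As_def shattered_subsets_def\<close>)+
  have cWs: "card Ws = (n choose (d + m))" unfolding Ws_def by (simp add: n_subsets)
  have "(\<Sum>W\<in>Ws. card {A\<in>As. A \<subseteq> W}) = (n - d choose m) * card As"
  proof (rule sum_multicount[OF fin(1,2)], clarify)
    fix A assume "A \<in> As"
    hence A: "A \<subseteq> {1..n}" "card A = d" by (auto simp: As_def shattered_subsets_def)
    show "card {W\<in>Ws. A \<subseteq> W} = (n - d choose m)"
      using card_supersets[of "{1..n}" A m] A by (simp add: Ws_def conj_assoc)
  qed
  hence "fact m * (real (n - d choose m) * real (card As))
      = (\<Sum>W\<in>Ws. fact m * real (card {A\<in>As. A \<subseteq> W}))"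
    by (simp flip: sum_distrib_left of_nat_sum of_nat_mult)
  also have "\<dots> \<le> (\<Sum>W\<in>Ws. good_density m * real (d + m) ^ m)"
  proof (rule sum_mono)
    fix W assume W: "W \<in> Ws"
    hence "{A\<in>As. A \<subseteq> W} = {A. A \<subseteq> W \<and> card A = d \<and> shatters F A}"
      by (auto simp: Ws_def As_def shattered_subsets_def)
    moreover have "finite W" using W finite_subset by (auto simp: Ws_def)
    ultimately show "fact m * real (card {A\<in>As. A \<subseteq> W}) \<le> good_density m * real (d + m) ^ m"
      using card_shattered_window_le[of W d m F] W fin(3) F(2) by (simp add: Ws_def)
  qed
  also have "\<dots> = real (n choose (d + m)) * (good_density m * real (d + m) ^ m)"
    by (simp add: cWs)
  finally have main: "fact m * (real (n - d choose m) * real (card As))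
      \<le> real (n choose (d + m)) * (good_density m * real (d + m) ^ m)" .
  define a b N K G where "a = real (n choose d)" and "b = real (n - d choose m)"
    and "N = real (n choose (d + m))" and "K = real (d + m choose d)"
    and "G = good_density m * real (d + m) ^ m"
  have pos: "0 < a" "0 < b" "0 < N" "0 \<le> G" using d good_density_nonneg[of m]
    by (auto simp: a_def b_def N_def G_def zero_less_binomial_iff)
  have NK: "N * K = a * b"
    using choose_mult[of d "d + m" n] d by (simp add: a_def b_def N_def K_def flip: of_nat_mult)
  have "fact d * real d ^ m \<le> real (fact (d + m))"
    using fact_mult_power_le[of d m] by (simp flip: of_nat_le_iff[where 'a = real])
  also have "real (fact (d + m)) = fact d * (fact m * K)"
    using binomial_fact[of d "d + m", where 'a = real] by (simp add: K_def)
  finally have K: "real d ^ m \<le> fact m * K" by simp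
  have "real d ^ m * real (card As) * b \<le> fact m * K * real (card As) * b"
    using K pos by (intro mult_right_mono) auto
  also have "\<dots> = K * (fact m * (b * real (card As)))" by simp
  also have "\<dots> \<le> K * (N * G)"
    using main by (intro mult_left_mono) (auto simp: b_def N_def G_def K_def)
  also have "\<dots> = a * G * b" using NK by (simp add: mult_ac)
  finally have "real d ^ m * real (card As) \<le> a * G" using pos by simp
  hence "real (card As) / a \<le> G / real d ^ m" using pos d(1) by (simp add: field_simps)
  thus ?thesis by (simp add: As_def a_def G_def power_divide)
qed

section \<open>Lower bound by linear codes\<close>

text \<open>Closure of a group together with one coset. Abstracting symmetric difference to
  \<open>f\<close> reduces the set reasoning to three identities.\<close>

lemma closed_Un_translate:
  assumes "\<And>x y. x \<in> G \<Longrightarrow> y \<in> G \<Longrightarrow> f x y \<in> G"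
    and "\<And>a b. f (f w a) b = f w (f a b)" "\<And>a b. f a (f w b) = f w (f a b)"
    and "\<And>a b. f (f w a) (f w b) = f a b"
    and "x \<in> G \<union> f w ` G" "y \<in> G \<union> f w ` G"
  shows "f x y \<in> G \<union> f w ` G"
proof -
  obtain a b where ab: "a \<in> G" "b \<in> G" "x = a \<or> x = f w a" "y = b \<or> y = f w b"
    using assms(5,6) by (elim UnE imageE) blast+
  have "f x y = f a b \<or> f x y = f w (f a b)"
    using ab(3,4)
  proof (elim disjE)
    assume "x = f w a" "y = b" thus ?thesis using assms(2) by blast
  next
    assume "x = a" "y = f w b" thus ?thesis using assms(3) by blast
  next
    assume "x = f w a" "y = f w b" thus ?thesis using assms(4) by blast
  qed blast
  thus ?thesis using assms(1)[OF ab(1,2)] by auto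
qed

text \<open>Adding a word \<open>w\<close> to a family \<open>G\<close> closed under symmetric difference doubles the trace on \<open>A\<close>
  unless \<open>w\<close> agrees on \<open>A\<close> with a member of \<open>G\<close>, which happens for at most \<open>card G * 2 ^ (n - d)\<close>
  words \<open>w\<close>. The averages over \<open>w\<close> multiply up to the product.\<close>

lemma exists_linear_family:
  assumes X: "finite X" "card X = n" and dn: "d \<le> n" and "i \<le> d"
  shows "\<exists>G \<subseteq> Pow X. card G \<le> 2 ^ i \<and> (\<forall>x\<in>G. \<forall>y\<in>G. sym_diff x y \<in> G) \<and>
    real (n choose d) * (\<Prod>j<i. 1 - 2 ^ j / 2 ^ d)
      \<le> real (card {A. A \<subseteq> X \<and> card A = d \<and> card ((\<lambda>x. x \<inter> A) ` G) = 2 ^ i})"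
  using \<open>i \<le> d\<close>
proof (induction i)
  case 0
  have "{A. A \<subseteq> X \<and> card A = d \<and> card ((\<lambda>x. x \<inter> A) ` {{}}) = 2 ^ 0}
      = {A. A \<subseteq> X \<and> card A = d}" by auto
  thus ?case using X by (intro exI[of _ "{{}}"]) (simp add: n_subsets)
next
  case (Suc i)
  obtain G where G: "G \<subseteq> Pow X" "card G \<le> 2 ^ i" "\<And>x y. x \<in> G \<Longrightarrow> y \<in> G \<Longrightarrow> sym_diff x y \<in> G"
    and cG: "real (n choose d) * (\<Prod>j<i. 1 - 2 ^ j / 2 ^ d)
      \<le> real (card {A. A \<subseteq> X \<and> card A = d \<and> card ((\<lambda>x. x \<inter> A) ` G) = 2 ^ i})"
    using Suc.IH Suc.prems by auto
  define As where "As = {A. A \<subseteq> X \<and> card A = d \<and> card ((\<lambda>x. x \<inter> A) ` G) = 2 ^ i}"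
  \<comment> \<open>Lower bound for the fraction of words whose trace on a given \<open>A\<close> in
    \<open>As\<close> is new.\<close>
  define q :: real where "q = 1 - 2 ^ i / 2 ^ d"
  have fG: "finite G" using G(1) X(1) finite_subset by blast
  have fAs: "finite As"
    by (rule finite_subset[of _ "Pow X"]) (use X in \<open>auto simp: As_def\<close>)
  have new: "2 ^ n * q \<le> real (card {w \<in> Pow X. w \<inter> A \<notin> (\<lambda>x. x \<inter> A) ` G})" if "A \<in> As" for A
  proof -
    have A: "A \<subseteq> X" "card A = d" "card ((\<lambda>x. x \<inter> A) ` G) = 2 ^ i" "finite A"
      using that X finite_subset by (auto simp: As_def)
    have "card {w \<in> Pow X. w \<inter> A \<in> (\<lambda>x. x \<inter> A) ` G} \<le> card ((\<lambda>x. x \<inter> A) ` G \<times> Pow (X - A))"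
    proof (rule card_inj_on_le[of "\<lambda>w. (w \<inter> A, w - A)"])
      show "inj_on (\<lambda>w. (w \<inter> A, w - A)) {w \<in> Pow X. w \<inter> A \<in> (\<lambda>x. x \<inter> A) ` G}"
        by (rule inj_onI) (metis Int_Diff_Un Pair_inject)
    qed (use X fG in auto)
    also have "\<dots> = 2 ^ i * 2 ^ (n - d)"
      using A X by (simp add: card_cartesian_product card_Pow card_Diff_subset)
    finally have "card {w \<in> Pow X. w \<inter> A \<in> (\<lambda>x. x \<inter> A) ` G} \<le> 2 ^ i * 2 ^ (n - d)" .
    from of_nat_mono[OF this, where 'a = real]
    have le: "real (card {w \<in> Pow X. w \<inter> A \<in> (\<lambda>x. x \<inter> A) ` G}) \<le> 2 ^ i * 2 ^ (n - d)"
      by (simp only: of_nat_mult of_nat_numeral of_nat_power)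
    have "card {w \<in> Pow X. w \<inter> A \<in> (\<lambda>x. x \<inter> A) ` G}
        + card {w \<in> Pow X. w \<inter> A \<notin> (\<lambda>x. x \<inter> A) ` G} = card (Pow X)"
      using X(1) by (intro card_filter_add_card_filter_not) simp
    also have "\<dots> = 2 ^ n" using X by (simp add: card_Pow)
    finally have "card {w \<in> Pow X. w \<inter> A \<in> (\<lambda>x. x \<inter> A) ` G}
        + card {w \<in> Pow X. w \<inter> A \<notin> (\<lambda>x. x \<inter> A) ` G} = 2 ^ n" .
    from arg_cong[OF this, of real]
    have "real (card {w \<in> Pow X. w \<inter> A \<in> (\<lambda>x. x \<inter> A) ` G})
        + real (card {w \<in> Pow X. w \<inter> A \<notin> (\<lambda>x. x \<inter> A) ` G}) = 2 ^ n"
      by (simp only: of_nat_add of_nat_numeral of_nat_power)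
    moreover have "(2::real) ^ n * q = 2 ^ n - 2 ^ i * 2 ^ (n - d)"
      using dn by (simp add: q_def algebra_simps power_diff)
    ultimately show ?thesis using le by linarith
  qed
  \<comment> \<open>First moment: some \<open>w\<close> does at least as well as the average over
    all words.\<close>
  have "\<exists>w\<in>Pow X. q * real (card As) \<le> real (card {A\<in>As. w \<inter> A \<notin> (\<lambda>x. x \<inter> A) ` G})"
  proof (rule ccontr)
    assume "\<not> ?thesis"
    hence "(\<Sum>w\<in>Pow X. real (card {A\<in>As. w \<inter> A \<notin> (\<lambda>x. x \<inter> A) ` G}))
        < (\<Sum>w\<in>Pow X. q * real (card As))"
      using X(1) by (intro sum_strict_mono) (auto simp: not_le)
    also have "\<dots> = (\<Sum>A\<in>As. 2 ^ n * q)" using X by (simp add: card_Pow mult_ac)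
    also have "\<dots> \<le> (\<Sum>A\<in>As. real (card {w \<in> Pow X. w \<inter> A \<notin> (\<lambda>x. x \<inter> A) ` G}))"
      by (intro sum_mono new)
    also have "\<dots> = (\<Sum>w\<in>Pow X. real (card {A\<in>As. w \<inter> A \<notin> (\<lambda>x. x \<inter> A) ` G}))"
      using sum_multicount_gen[of "Pow X" As "\<lambda>w A. w \<inter> A \<notin> (\<lambda>x. x \<inter> A) ` G"
          "\<lambda>A. card {w \<in> Pow X. w \<inter> A \<notin> (\<lambda>x. x \<inter> A) ` G}"] X(1) fAs
      by (simp flip: of_nat_sum)
    finally show False by simp
  qed
  then obtain w where w: "w \<subseteq> X"
    "q * real (card As) \<le> real (card {A\<in>As. w \<inter> A \<notin> (\<lambda>x. x \<inter> A) ` G})" by auto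
  define G' where "G' = G \<union> sym_diff w ` G"
  have "G' \<subseteq> Pow X" using G(1) w(1) by (auto simp: G'_def)
  moreover have "card G' \<le> 2 ^ Suc i"
    unfolding G'_def using card_Un_le[of G "sym_diff w ` G"] card_image_le[OF fG, of "sym_diff w"] G(2)
    by simp
  moreover have "sym_diff x y \<in> G'" if "x \<in> G'" "y \<in> G'" for x y
    using that unfolding G'_def
    by (intro closed_Un_translate[where f = sym_diff] G(3)) blast+
  moreover have "real (n choose d) * (\<Prod>j<Suc i. 1 - 2 ^ j / 2 ^ d)
      \<le> real (card {A. A \<subseteq> X \<and> card A = d \<and> card ((\<lambda>x. x \<inter> A) ` G') = 2 ^ Suc i})"
  proof -
    have "0 \<le> q" using Suc.prems by (simp add: q_def power_increasing)
    hence "real (n choose d) * (\<Prod>j<i. 1 - 2 ^ j / 2 ^ d) * q \<le> real (card As) * q"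
      using cG by (intro mult_right_mono) (simp_all add: As_def)
    also have "\<dots> \<le> real (card {A\<in>As. w \<inter> A \<notin> (\<lambda>x. x \<inter> A) ` G})"
      using w(2) by (simp add: mult.commute)
    also have "\<dots> \<le> real (card {A. A \<subseteq> X \<and> card A = d \<and> card ((\<lambda>x. x \<inter> A) ` G') = 2 ^ Suc i})"
    proof (intro of_nat_mono card_mono)
      show "finite {A. A \<subseteq> X \<and> card A = d \<and> card ((\<lambda>x. x \<inter> A) ` G') = 2 ^ Suc i}"
        by (rule finite_subset[of _ "Pow X"]) (use X in auto)
      show "{A\<in>As. w \<inter> A \<notin> (\<lambda>x. x \<inter> A) ` G}
          \<subseteq> {A. A \<subseteq> X \<and> card A = d \<and> card ((\<lambda>x. x \<inter> A) ` G') = 2 ^ Suc i}"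
      proof clarify
        fix A assume "A \<in> As" and wA: "w \<inter> A \<notin> (\<lambda>x. x \<inter> A) ` G"
        hence A: "A \<subseteq> X" "card A = d" "card ((\<lambda>x. x \<inter> A) ` G) = 2 ^ i" by (auto simp: As_def)
        define H where "H = (\<lambda>x. x \<inter> A) ` G"
        have sd: "sym_diff w x \<inter> A = sym_diff (w \<inter> A) (x \<inter> A)" for x by blast
        have G'H: "(\<lambda>x. x \<inter> A) ` G' = H \<union> sym_diff (w \<inter> A) ` H"
          unfolding G'_def H_def image_Un image_image sd ..
        have "H \<inter> sym_diff (w \<inter> A) ` H = {}"
        proof (rule ccontr)
          assume "\<not> ?thesis"
          then obtain x y where xy: "x \<in> G" "y \<in> G" "y \<inter> A = sym_diff (w \<inter> A) (x \<inter> A)"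
            unfolding H_def by blast
          hence "w \<inter> A = sym_diff x y \<inter> A" by blast
          thus False using wA G(3)[OF xy(1,2)] by blast
        qed
        moreover have "finite H" using fG by (simp add: H_def)
        ultimately have "card ((\<lambda>x. x \<inter> A) ` G') = card H + card (sym_diff (w \<inter> A) ` H)"
          unfolding G'H by (intro card_Un_disjoint finite_imageI)
        moreover have "inj_on (sym_diff (w \<inter> A)) H" by (rule inj_onI) blast
        hence "card (sym_diff (w \<inter> A) ` H) = card H" by (rule card_image)
        ultimately have "card ((\<lambda>x. x \<inter> A) ` G') = 2 ^ Suc i" using A(3) by (simp add: H_def)
        thus "A \<subseteq> X \<and> card A = d \<and> card ((\<lambda>x. x \<inter> A) ` G') = 2 ^ Suc i" using A by simp
      qed
    qed
    finally show ?thesis by (simp add: q_def mult.assoc)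
  qed
  ultimately show ?case by (intro exI[of _ G'] conjI ballI)
qed

text \<open>At \<open>i = d\<close> a trace of size \<open>2 ^ d\<close> is all of
  \<open>Pow A\<close>; reversing the index turns the product into
  \<open>euler_partial d\<close>.\<close>

lemma exists_family_shattering_many:
  assumes "d \<le> n"
  obtains F where "F \<subseteq> Pow {1..n}" "card F \<le> 2 ^ d"
    "real (n choose d) * euler_partial d \<le> real (card (shattered_subsets n d F))"
proof -
  obtain G where G: "G \<subseteq> Pow {1..n}" "card G \<le> 2 ^ d"
    and cG: "real (n choose d) * (\<Prod>j<d. 1 - 2 ^ j / 2 ^ d)
      \<le> real (card {A. A \<subseteq> {1..n} \<and> card A = d \<and> card ((\<lambda>x. x \<inter> A) ` G) = 2 ^ d})"
    using exists_linear_family[of "{1..n}" n d d] assms by auto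
  have "(\<Prod>j<d. 1 - 2 ^ j / 2 ^ d) = (\<Prod>i<d. 1 - 2 ^ (d - Suc i) / (2::real) ^ d)"
    by (rule prod.nat_diff_reindex[symmetric])
  also have "\<dots> = euler_partial d" unfolding euler_partial_def
  proof (intro prod.cong refl)
    fix i assume "i \<in> {..<d}"
    hence "d = (d - Suc i) + (i + 1)" by simp
    hence "(2::real) ^ d = 2 ^ (d - Suc i) * 2 ^ (i + 1)" by (metis power_add)
    thus "1 - 2 ^ (d - Suc i) / 2 ^ d = 1 - 1 / (2::real) ^ (i + 1)" by simp
  qed
  finally have prod_eq: "(\<Prod>j<d. 1 - 2 ^ j / 2 ^ d) = euler_partial d" .
  have "{A. A \<subseteq> {1..n} \<and> card A = d \<and> card ((\<lambda>x. x \<inter> A) ` G) = 2 ^ d} \<subseteq> shattered_subsets n d G"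
  proof clarify
    fix A assume A: "A \<subseteq> {1..n}" "d = card A" "card ((\<lambda>x. x \<inter> A) ` G) = 2 ^ card A"
    have "finite A" using A(1) finite_subset by blast
    hence "(\<lambda>x. x \<inter> A) ` G = Pow A"
      using A(3) by (intro card_subset_eq) (auto simp: card_Pow)
    thus "A \<in> shattered_subsets n (card A) G"
      using A by (simp add: shattered_subsets_def shatters_iff_image)
  qed
  moreover have "finite (shattered_subsets n d G)"
    by (rule finite_subset[of _ "Pow {1..n}"]) (auto simp: shattered_subsets_def)
  ultimately have "card {A. A \<subseteq> {1..n} \<and> card A = d \<and> card ((\<lambda>x. x \<inter> A) ` G) = 2 ^ d}
      \<le> card (shattered_subsets n d G)" by (rule card_mono[rotated])
  with cG G show ?thesis unfolding prod_eq by (intro that[of G]) linarith+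
qed

section \<open>Bounds for the maximum and passage to the limit\<close>

lemma max_shattered_ratio_ge:
  assumes "d \<le> n"
  shows "euler_partial d \<le> real (max_shattered n (2 ^ d) d) / real (n choose d)"
proof -
  obtain F where F: "F \<subseteq> Pow {1..n}" "card F \<le> 2 ^ d"
    "real (n choose d) * euler_partial d \<le> real (card (shattered_subsets n d F))"
    by (rule exists_family_shattering_many[OF assms])
  have "card (shattered_subsets n d F) \<le> max_shattered n (2 ^ d) d"
    unfolding max_shattered_def using F finite_families by (intro Max_ge) auto
  hence "real (n choose d) * euler_partial d \<le> real (max_shattered n (2 ^ d) d)"
    using F(3) by linarith
  moreover have "0 < real (n choose d)" using assms by (simp add: zero_less_binomial_iff)
  ultimately show ?thesis by (simp add: pos_le_divide_eq mult.commute)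
qed

lemma max_shattered_ratio_le:
  assumes "0 < d" "d + m \<le> n"
  shows "real (max_shattered n (2 ^ d) d) / real (n choose d)
    \<le> good_density m * (real (d + m) / real d) ^ m"
proof -
  have "max_shattered n (2 ^ d) d
      \<in> (\<lambda>F. card (shattered_subsets n d F)) ` {F. F \<subseteq> Pow {1..n} \<and> card F \<le> 2 ^ d}"
    unfolding max_shattered_def
    by (intro Max_in finite_imageI finite_families) (simp only: image_is_empty families_nonempty simp_thms)
  thus ?thesis using card_shattered_subsets_le[OF assms] by auto
qed

theorem theorem1p2:
  fixes n d :: "nat \<Rightarrow> nat" and c :: real
  defines "c \<equiv> (\<Prod>i. 1 - 1 / 2 ^ (i + 1))"
  assumes "\<And>j. j \<ge> 1 \<Longrightarrow> 0 < n j"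
    and "\<And>j. j \<ge> 1 \<Longrightarrow> 0 < d j"
    and "\<And>j. j \<ge> 1 \<Longrightarrow> d j \<le> n j"
    and "filterlim d at_top sequentially"
    and "filterlim (\<lambda>j. n j - d j) at_top sequentially"
  shows "(\<lambda>j. real (max_shattered (n j) (2 ^ d j) (d j)) / real (n j choose d j)) \<longlonglongrightarrow> c
    \<and> \<bar>c - 0.289\<bar> < 0.0005"
proof
  show "(\<lambda>j. real (max_shattered (n j) (2 ^ d j) (d j)) / real (n j choose d j)) \<longlonglongrightarrow> c"
  proof (rule order_tendstoI)
    fix a assume a: "a < c"
    \<comment> \<open>At every \<open>j \<ge> 1\<close> the ratio is at least
      \<open>euler_partial (d j)\<close>, hence at least \<open>c\<close>.\<close>
    show "eventually (\<lambda>j. a < real (max_shattered (n j) (2 ^ d j) (d j)) / real (n j choose d j))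
        sequentially"
      using eventually_ge_at_top[of 1]
    proof eventually_elim
      case (elim j)
      show ?case
        using a euler_product_bounds(1)[of "d j"] max_shattered_ratio_ge[OF assms(4)[OF elim]]
        unfolding c_def by linarith
    qed
  next
    fix a assume "c < a"
    \<comment> \<open>First \<open>m\<close> is fixed with \<open>good_density m < a\<close>. Then
      growth of \<open>d j\<close> sends the error factor to 1, and growth of
      \<open>n j - d j\<close> makes room for windows of size \<open>d j + m\<close>.\<close>
    moreover have "good_density \<longlonglongrightarrow> c" unfolding c_def by (rule good_density_LIMSEQ)
    ultimately have "eventually (\<lambda>m. good_density m < a) sequentially"
      by (rule order_tendstoD(2)[rotated])
    then obtain m where m: "good_density m < a" unfolding eventually_sequentially by blast
    have "(\<lambda>k. real (k + m) / real k) \<longlonglongrightarrow> 1" by real_asymp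
    hence "(\<lambda>k. good_density m * (real (k + m) / real k) ^ m) \<longlonglongrightarrow> good_density m * 1 ^ m"
      by (intro tendsto_intros)
    from filterlim_compose[OF this assms(5)]
    have "(\<lambda>j. good_density m * (real (d j + m) / real (d j)) ^ m) \<longlonglongrightarrow> good_density m" by simp
    hence "eventually (\<lambda>j. good_density m * (real (d j + m) / real (d j)) ^ m < a) sequentially"
      using m by (rule order_tendstoD(2))
    moreover have "eventually (\<lambda>j. m \<le> n j - d j) sequentially"
      using assms(6) by (simp add: filterlim_at_top)
    ultimately show "eventually
        (\<lambda>j. real (max_shattered (n j) (2 ^ d j) (d j)) / real (n j choose d j) < a) sequentially"
      using eventually_ge_at_top[of 1]
    proof eventually_elim
      case (elim j)
      have "d j + m \<le> n j" using elim(2) assms(4)[OF elim(3)] by simp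
      from max_shattered_ratio_le[OF assms(3)[OF elim(3)] this] elim(1) show ?case by linarith
    qed
  qed
  show "\<bar>c - 0.289\<bar> < 0.0005" unfolding c_def by (rule euler_product_approx)
qed

end
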